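(* Consider the Ising chain on $\mathbb{Z}$ with nearest-neighbour coupling $K>0$ and no external field ($h=0$). Let $K_0=K$ and let the couplings $K_n$ of the Hamiltonians $\mathcal{H}_{\lambda=2^n}$ be determined by the renormalization group transformation $$K_n=-\frac12\log\left(\frac{2}{e^{K_{n-1}}+e^{-K_{n-1}}}\right),\qquad n\ge1,$$ with zero external field. Let $f,g:\{+1,-1\}\to\mathbb{R}$ and let $\mathcal{S}^{fg}_{\lambda=2^n}(x_1,x_2)=\hat{\mathcal{S}}^{fg}_{\lambda=2^n}(x_1,x_2)-\tilde{\mathcal{S}}^{fg}_{\lambda=2^n}(x_1,x_2)$ be the two point observables corresponding to $\mathcal{H}_{\lambda=2^n}$, with $\mathcal{S}^{fg}=\mathcal{S}^{fg}_{\lambda=1}$ (and likewise for $\hat{\mathcal{S}}^{fg}$, $\tilde{\mathcal{S}}^{fg}$). Then for any $x_1,x_2\in\mathbb{Z}$ the remainder terms $$\hat{\mathcal{O}}_n(x_1,x_2)=\hat{\mathcal{S}}^{fg}_{\lambda=2^n}(x_1,x_2)-\hat{\mathcal{S}}^{fg}(2^nx_1,2^nx_2),\qquad \tilde{\mathcal{O}}_n(x_1,x_2)=\tilde{\mathcal{S}}^{fg}_{\lambda=2^n}(x_1,x_2)-\tilde{\mathcal{S}}^{fg}(2^nx_1,2^nx_2)$$ both decay to $0$ exponentially as $n\to\infty$.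
   Context: For coupling $\kappa\ge0$, the zero-field Ising measure with periodic boundary conditions on $N$ sites is $\mathbb{P}_N(\sigma)=Z_N^{-1}\exp\{\kappa\sum_{k=1}^N\sigma_k\sigma_{k+1}\}$ on $\{\pm1\}^N$, $\sigma_{N+1}=\sigma_1$ (indices modulo $N$). The two point observable with coupling $\kappa$ has the two parts $$\hat{\mathcal{S}}^{fg}(x_1,x_2)=\lim_{N\to\infty}\langle f^2(\sigma_{x_1})g^2(\sigma_{x_2})\log(f^2(\sigma_{x_1})g^2(\sigma_{x_2}))\rangle_{\mathbb{P}_N},$$ $$\tilde{\mathcal{S}}^{fg}(x_1,x_2)=\lim_{N\to\infty}\langle f^2(\sigma_{x_1})g^2(\sigma_{x_2})\rangle_{\mathbb{P}_N}\log\langle f^2(\sigma_{x_1})g^2(\sigma_{x_2})\rangle_{\mathbb{P}_N},$$ with $0\log0=0$. Without subscript these are taken at $\kappa=K$; with subscript $\lambda=2^n$ at $\kappa=K_n$. "Decay to $0$ exponentially" means bounded in absolute value by $C\rho^n$ for all $n\ge1$, for some $C>0$ and $\rho\in(0,1)$ which may depend on $K,f,g,x_1,x_2$. *)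

theory Defs
  imports "HOL-Analysis.Analysis"
begin

text \<open>The \<open>N\<close> sites of the periodic chain are represented by the residues \<open>0, \<dots>, N - 1\<close>, and
  a site label \<open>x\<close> (any integer) denotes the site \<open>x mod N\<close>.\<close>

definition spin_at :: "nat \<Rightarrow> (int \<Rightarrow> real) \<Rightarrow> int \<Rightarrow> real" where
  "spin_at N \<sigma> x = \<sigma> (x mod int N)"

definition ising_configs :: "nat \<Rightarrow> (int \<Rightarrow> real) set" where
  "ising_configs N = {0..<int N} \<rightarrow>\<^sub>E {- 1, 1}"

definition ising_weight :: "real \<Rightarrow> nat \<Rightarrow> (int \<Rightarrow> real) \<Rightarrow> real" where
  "ising_weight \<kappa> N \<sigma> = exp (\<kappa> * (\<Sum>k = 1..int N. spin_at N \<sigma> k * spin_at N \<sigma> (k + 1)))"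

definition ising_partition :: "real \<Rightarrow> nat \<Rightarrow> real" where
  "ising_partition \<kappa> N = (\<Sum>\<sigma>\<in>ising_configs N. ising_weight \<kappa> N \<sigma>)"

definition ising_measure :: "real \<Rightarrow> nat \<Rightarrow> (int \<Rightarrow> real) measure" where
  "ising_measure \<kappa> N =
     point_measure (ising_configs N) (\<lambda>\<sigma>. ennreal (ising_weight \<kappa> N \<sigma> / ising_partition \<kappa> N))"

definition ising_expectation :: "real \<Rightarrow> nat \<Rightarrow> ((int \<Rightarrow> real) \<Rightarrow> real) \<Rightarrow> real" where
  "ising_expectation \<kappa> N F = integral\<^sup>L (ising_measure \<kappa> N) F"

text \<open>The convention \<open>0 log 0 = 0\<close> holds because of the factor \<open>t\<close>, whatever value \<open>ln 0\<close> has.\<close>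

definition xlogx :: "real \<Rightarrow> real" where
  "xlogx t = t * ln t"

text \<open>Functions on the spin space \<open>{+1, -1}\<close> are given as functions on \<open>real\<close>; only their values at
  \<open>1\<close> and \<open>-1\<close> are ever used.\<close>

definition two_point :: "(real \<Rightarrow> real) \<Rightarrow> (real \<Rightarrow> real) \<Rightarrow> nat \<Rightarrow> int \<Rightarrow> int \<Rightarrow> (int \<Rightarrow> real) \<Rightarrow> real"
  where
  "two_point f g N x1 x2 \<sigma> = (f (spin_at N \<sigma> x1))\<^sup>2 * (g (spin_at N \<sigma> x2))\<^sup>2"

definition S_hat :: "real \<Rightarrow> (real \<Rightarrow> real) \<Rightarrow> (real \<Rightarrow> real) \<Rightarrow> int \<Rightarrow> int \<Rightarrow> real" where
  "S_hat \<kappa> f g x1 x2 =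
     lim (\<lambda>N. ising_expectation \<kappa> N (\<lambda>\<sigma>. xlogx (two_point f g N x1 x2 \<sigma>)))"

definition S_tilde :: "real \<Rightarrow> (real \<Rightarrow> real) \<Rightarrow> (real \<Rightarrow> real) \<Rightarrow> int \<Rightarrow> int \<Rightarrow> real" where
  "S_tilde \<kappa> f g x1 x2 =
     lim (\<lambda>N. xlogx (ising_expectation \<kappa> N (two_point f g N x1 x2)))"

primrec rg_coupling :: "real \<Rightarrow> nat \<Rightarrow> real" where
  "rg_coupling K 0 = K"
| "rg_coupling K (Suc n) =
     - (1 / 2) * ln (2 / (exp (rg_coupling K n) + exp (- rg_coupling K n)))"

definition O_hat :: "real \<Rightarrow> (real \<Rightarrow> real) \<Rightarrow> (real \<Rightarrow> real) \<Rightarrow> int \<Rightarrow> int \<Rightarrow> nat \<Rightarrow> real" where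
  "O_hat K f g x1 x2 n =
     S_hat (rg_coupling K n) f g x1 x2 - S_hat K f g (2 ^ n * x1) (2 ^ n * x2)"

definition O_tilde :: "real \<Rightarrow> (real \<Rightarrow> real) \<Rightarrow> (real \<Rightarrow> real) \<Rightarrow> int \<Rightarrow> int \<Rightarrow> nat \<Rightarrow> real" where
  "O_tilde K f g x1 x2 n =
     S_tilde (rg_coupling K n) f g x1 x2 - S_tilde K f g (2 ^ n * x1) (2 ^ n * x2)"

definition decays_exponentially :: "(nat \<Rightarrow> real) \<Rightarrow> bool" where
  "decays_exponentially a \<longleftrightarrow>
     (\<exists>C \<rho>. C > 0 \<and> 0 < \<rho> \<and> \<rho> < 1 \<and> (\<forall>n\<ge>1. \<bar>a n\<bar> \<le> C * \<rho> ^ n))"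

end

theory Submission
  imports Defs "HOL-Real_Asymp.Real_Asymp"
begin

text \<open>
  For a ring of \<open>N\<close> spins and arbitrary bond factors,
  \<open>\<Sum>\<^sub>\<sigma> \<Prod>\<^sub>k (a\<^sub>k + b\<^sub>k \<sigma>\<^sub>k \<sigma>\<^sub>k\<^sub>+\<^sub>1) = 2\<^sup>N (\<Prod>\<^sub>k a\<^sub>k + \<Prod>\<^sub>k b\<^sub>k)\<close>. The Boltzmann factor of a bond is
  \<open>cosh \<kappa> + sinh \<kappa> \<sigma>\<^sub>k \<sigma>\<^sub>k\<^sub>+\<^sub>1\<close>, and inserting \<open>\<sigma>\<^sub>p \<sigma>\<^sub>q\<close> multiplies each bond between \<open>p\<close> and \<open>q\<close> by
  \<open>\<sigma>\<^sub>k \<sigma>\<^sub>k\<^sub>+\<^sub>1\<close>, i.e. exchanges its two coefficients. With \<open>t = tanh \<kappa>\<close> and \<open>d = \<bar>x\<^sub>1 - x\<^sub>2\<bar>\<close> the correlation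
  is therefore \<open>(t\<^sup>d + t\<^sup>N\<^sup>-\<^sup>d) / (1 + t\<^sup>N)\<close>, which tends to \<open>t\<^sup>d\<close>. As a function on \<open>{1, -1}\<^sup>2\<close> is an
  affine combination of \<open>1, \<sigma>, \<tau>, \<sigma>\<tau>\<close>, both parts of the observable are explicit functions of
  \<open>t\<^sup>d\<close>. Since \<open>0 \<le> K\<^sub>n \<le> K / 2\<^sup>n\<close>, both \<open>tanh K\<^sub>n ^ d\<close> and \<open>tanh K ^ (2\<^sup>n d)\<close> decay exponentially
  when \<open>d > 0\<close>, and \<open>x log x\<close> is Lipschitz on the compact subinterval of \<open>(0, \<infinity>)\<close> that occurs.
\<close>

section \<open>Sums of bond products over the ring\<close>

lemma sum_PiE_insert:
  fixes F :: "('a \<Rightarrow> 'b) \<Rightarrow> 'c::comm_monoid_add"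
  assumes "i \<notin> A"
  shows "(\<Sum>\<sigma>\<in>insert i A \<rightarrow>\<^sub>E S. F \<sigma>) = (\<Sum>\<sigma>\<in>A \<rightarrow>\<^sub>E S. \<Sum>s\<in>S. F (\<sigma>(i := s)))"
proof -
  have "(\<Sum>\<sigma>\<in>insert i A \<rightarrow>\<^sub>E S. F \<sigma>) = (\<Sum>(s, \<sigma>)\<in>S \<times> (A \<rightarrow>\<^sub>E S). F (\<sigma>(i := s)))"
    unfolding PiE_insert_eq
    using inj_combinator[OF assms, of "\<lambda>_. S"]
    by (subst sum.reindex) (auto simp: case_prod_unfold)
  also have "\<dots> = (\<Sum>s\<in>S. \<Sum>\<sigma>\<in>A \<rightarrow>\<^sub>E S. F (\<sigma>(i := s)))"
    by (rule sum.cartesian_product[symmetric])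
  also have "\<dots> = (\<Sum>\<sigma>\<in>A \<rightarrow>\<^sub>E S. \<Sum>s\<in>S. F (\<sigma>(i := s)))"
    by (rule sum.swap)
  finally show ?thesis .
qed

lemma ising_configs_spin: "\<sigma> \<in> ising_configs N \<Longrightarrow> 0 \<le> k \<Longrightarrow> k < int N \<Longrightarrow> \<sigma> k = - 1 \<or> \<sigma> k = 1"
  by (auto simp: ising_configs_def PiE_def Pi_def)

lemma spin_at_cases:
  assumes "\<sigma> \<in> ising_configs N" "N > 0"
  shows "spin_at N \<sigma> x = - 1 \<or> spin_at N \<sigma> x = 1"
  unfolding spin_at_def using assms by (intro ising_configs_spin) auto

lemma finite_ising_configs: "finite (ising_configs N)"
  unfolding ising_configs_def by (intro finite_PiE) auto

lemma sum_ising_configs_Suc: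
  "(\<Sum>\<sigma>\<in>ising_configs (Suc n). F \<sigma>) =
    (\<Sum>\<sigma>\<in>ising_configs n. F (\<sigma>(int n := - 1)) + F (\<sigma>(int n := 1)))"
proof -
  have "{0..<int (Suc n)} = insert (int n) {0..<int n}" by auto
  then show ?thesis unfolding ising_configs_def by (simp add: sum_PiE_insert)
qed

text \<open>The closing bond \<open>c + d \<sigma>\<^sub>n \<sigma>\<^sub>0\<close> is kept general: summing over the last spin merges it with the
  bond before it.\<close>

lemma sum_ring:
  fixes a b :: "nat \<Rightarrow> real"
  shows "(\<Sum>\<sigma>\<in>ising_configs (Suc n).
      (\<Prod>k<n. a k + b k * (\<sigma> (int k) * \<sigma> (int k + 1))) * (c + d * (\<sigma> (int n) * \<sigma> 0)))
    = 2 ^ Suc n * ((\<Prod>k<n. a k) * c + (\<Prod>k<n. b k) * d)"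
proof (induction n arbitrary: c d)
  case 0
  show ?case by (simp add: sum_ising_configs_Suc) (simp add: ising_configs_def)
next
  case (Suc n)
  let ?P = "\<lambda>\<sigma>. \<Prod>k<n. a k + b k * (\<sigma> (int k) * \<sigma> (int k + 1))"
  have P: "?P (\<sigma>(int (Suc n) := s)) = ?P \<sigma>" for \<sigma> s
    by (intro prod.cong) auto
  \<comment> \<open>In the sum over the last spin s the terms odd in s cancel and s * s = 1. What is
    left is twice a closing bond with coefficients \<open>a n * c\<close> and
    \<open>b n * d\<close>.\<close>
  have "(\<Sum>\<sigma>\<in>ising_configs (Suc (Suc n)).
      (\<Prod>k<Suc n. a k + b k * (\<sigma> (int k) * \<sigma> (int k + 1))) * (c + d * (\<sigma> (int (Suc n)) * \<sigma> 0)))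
    = (\<Sum>\<sigma>\<in>ising_configs (Suc n). 2 * (?P \<sigma> * (a n * c + b n * d * (\<sigma> (int n) * \<sigma> 0))))"
    unfolding sum_ising_configs_Suc[of _ "Suc n"] prod.lessThan_Suc P
    by (intro sum.cong) (auto simp: algebra_simps)
  also have "\<dots> = 2 ^ Suc (Suc n) * ((\<Prod>k<n. a k) * (a n * c) + (\<Prod>k<n. b k) * (b n * d))"
    unfolding sum_distrib_left[symmetric] Suc.IH by simp
  finally show ?case by (simp add: algebra_simps)
qed

lemma sum_ring_periodic:
  fixes a b :: "nat \<Rightarrow> real"
  assumes "N > 0"
  shows "(\<Sum>\<sigma>\<in>ising_configs N. \<Prod>k<N. a k + b k * (spin_at N \<sigma> (int k) * spin_at N \<sigma> (int k + 1)))
    = 2 ^ N * ((\<Prod>k<N. a k) + (\<Prod>k<N. b k))"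
proof -
  obtain n where N: "N = Suc n" using assms by (cases N) auto
  have last: "(int n + 1) mod int (Suc n) = 0" by (simp add: add.commute)
  have "(\<Prod>k<N. a k + b k * (spin_at N \<sigma> (int k) * spin_at N \<sigma> (int k + 1)))
    = (\<Prod>k<n. a k + b k * (\<sigma> (int k) * \<sigma> (int k + 1))) * (a n + b n * (\<sigma> (int n) * \<sigma> 0))" for \<sigma>
    unfolding N prod.lessThan_Suc spin_at_def last
    by (intro arg_cong2[of _ _ _ _ "(*)"] prod.cong) auto
  then show ?thesis using sum_ring[of a b n "a n" "b n"] by (simp add: N)
qed

section \<open>Boltzmann weight and partition function\<close>

lemma ising_weight_prod:
  assumes "\<sigma> \<in> ising_configs N" "N > 0"
  shows "ising_weight \<kappa> N \<sigma> =
    (\<Prod>k<N. cosh \<kappa> + sinh \<kappa> * (spin_at N \<sigma> (int k) * spin_at N \<sigma> (int k + 1)))"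
proof -
  let ?h = "\<lambda>k. spin_at N \<sigma> k * spin_at N \<sigma> (k + 1)"
  have bond: "exp (\<kappa> * ?h k) = cosh \<kappa> + sinh \<kappa> * ?h k" for k
    using spin_at_cases[OF assms, of k] spin_at_cases[OF assms, of "k + 1"]
    by (auto simp: cosh_plus_sinh cosh_minus_sinh)
  obtain n where N: "N = Suc n" using assms(2) by (cases N) auto
  have per: "?h (int N) = ?h 0" by (simp add: spin_at_def)
  \<comment> \<open>The weight numbers the bonds 1 to N, the ring sum 0 to N - 1; periodicity
    identifies bond N with bond 0.\<close>
  have "(\<Sum>k = 1..int N. ?h k) = (\<Sum>k<N. ?h (int (Suc k)))"
    by (rule sum.reindex_bij_witness[of _ "\<lambda>k. int k + 1" "\<lambda>k. nat (k - 1)"]) (auto simp: add.commute)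
  also have "\<dots> = (\<Sum>k<n. ?h (int (Suc k))) + ?h (int N)"
    by (simp add: N)
  also have "\<dots> = (\<Sum>k<N. ?h (int k))"
    unfolding per unfolding N sum.lessThan_Suc_shift by simp
  finally have "ising_weight \<kappa> N \<sigma> = exp (\<Sum>k<N. \<kappa> * ?h (int k))"
    unfolding ising_weight_def by (simp add: sum_distrib_left)
  also have "\<dots> = (\<Prod>k<N. cosh \<kappa> + sinh \<kappa> * ?h (int k))"
    by (simp add: exp_sum bond)
  finally show ?thesis .
qed

lemma ising_partition_eq:
  assumes "N > 0"
  shows "ising_partition \<kappa> N = 2 ^ N * (cosh \<kappa> ^ N + sinh \<kappa> ^ N)"
proof -
  have "ising_partition \<kappa> N = (\<Sum>\<sigma>\<in>ising_configs N.
      \<Prod>k<N. cosh \<kappa> + sinh \<kappa> * (spin_at N \<sigma> (int k) * spin_at N \<sigma> (int k + 1)))"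
    unfolding ising_partition_def by (intro sum.cong) (auto simp: ising_weight_prod assms)
  then show ?thesis
    using sum_ring_periodic[OF assms, of "\<lambda>_. cosh \<kappa>" "\<lambda>_. sinh \<kappa>"] by simp
qed

lemma ising_partition_pos:
  assumes "\<kappa> \<ge> 0" "N > 0"
  shows "ising_partition \<kappa> N > 0"
  unfolding ising_partition_eq[OF assms(2)] using assms
  by (intro mult_pos_pos add_pos_nonneg) auto

section \<open>Spin correlations on the finite ring\<close>

lemma spin_pair_prod:
  fixes s :: "nat \<Rightarrow> real"
  assumes "p \<le> q" "\<And>k. s k * s k = 1"
  shows "(\<Prod>k\<in>{p..<q}. s k * s (Suc k)) = s p * s q"
  using assms(1)
proof (induction q rule: dec_induct)
  case base
  show ?case by (simp add: assms)
next
  case (step n)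
  have "s p * s n * (s n * s (Suc n)) = s p * s (Suc n) * (s n * s n)" by (simp only: mult_ac)
  then show ?case using step by (simp add: prod.atLeastLessThan_Suc assms(2))
qed

lemma sum_spin_pair_ordered:
  assumes "p \<le> q" "q < N"
  shows "(\<Sum>\<sigma>\<in>ising_configs N. ising_weight \<kappa> N \<sigma> * (spin_at N \<sigma> (int p) * spin_at N \<sigma> (int q)))
    = 2 ^ N * (sinh \<kappa> ^ (q - p) * cosh \<kappa> ^ (N - (q - p)) + cosh \<kappa> ^ (q - p) * sinh \<kappa> ^ (N - (q - p)))"
proof -
  have N: "N > 0" using assms by auto
  let ?I = "{p..<q}"
  \<comment> \<open>Bond coefficients after the exchange on the q - p bonds from p to q; the
    products of all \<open>a k\<close> and of all \<open>b k\<close> become the two terms of the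
    result.\<close>
  define a where "a = (\<lambda>k. if k \<in> ?I then sinh \<kappa> else cosh \<kappa>)"
  define b where "b = (\<lambda>k. if k \<in> ?I then cosh \<kappa> else sinh \<kappa>)"
  have I: "?I \<subseteq> {..<N}" using assms by auto
  have split: "(\<Prod>k<N. if k \<in> ?I then u k else v k) = (\<Prod>k\<in>?I. u k) * (\<Prod>k\<in>{..<N} - ?I. v k)"
    for u v :: "nat \<Rightarrow> real"
    unfolding prod.subset_diff[OF I finite_lessThan] mult.commute[of "prod _ ({..<N} - ?I)"]
    by (intro arg_cong2[of _ _ _ _ "(*)"] prod.cong) auto
  have card: "card ({..<N} - ?I) = N - (q - p)" using I by (simp add: card_Diff_subset)
  have "ising_weight \<kappa> N \<sigma> * (spin_at N \<sigma> (int p) * spin_at N \<sigma> (int q))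
    = (\<Prod>k<N. a k + b k * (spin_at N \<sigma> (int k) * spin_at N \<sigma> (int k + 1)))"
    if \<sigma>: "\<sigma> \<in> ising_configs N" for \<sigma>
  proof -
    define s where "s = (\<lambda>k. spin_at N \<sigma> (int k))"
    have s: "s k * s k = 1" for k
      using spin_at_cases[OF \<sigma> N, of "int k"] by (auto simp: s_def)
    have sS: "spin_at N \<sigma> (int k + 1) = s (Suc k)" for k by (simp add: s_def add.commute)
    have "s p * s q = (\<Prod>k<N. if k \<in> ?I then s k * s (Suc k) else 1)"
      using spin_pair_prod[OF assms(1), of s] s unfolding split by simp
    moreover have "ising_weight \<kappa> N \<sigma> = (\<Prod>k<N. cosh \<kappa> + sinh \<kappa> * (s k * s (Suc k)))"
      unfolding ising_weight_prod[OF \<sigma> N] sS by (simp add: s_def)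
    ultimately have "ising_weight \<kappa> N \<sigma> * (s p * s q)
        = (\<Prod>k<N. (cosh \<kappa> + sinh \<kappa> * (s k * s (Suc k))) * (if k \<in> ?I then s k * s (Suc k) else 1))"
      by (simp add: prod.distrib)
    also have "\<dots> = (\<Prod>k<N. a k + b k * (s k * s (Suc k)))"
    proof (intro prod.cong refl)
      fix k
      have "(s k * s (Suc k)) * (s k * s (Suc k)) = (s k * s k) * (s (Suc k) * s (Suc k))"
        by (simp only: mult_ac)
      then have "(s k * s (Suc k)) * (s k * s (Suc k)) = 1" using s by simp
      then show "(cosh \<kappa> + sinh \<kappa> * (s k * s (Suc k))) * (if k \<in> ?I then s k * s (Suc k) else 1)
          = a k + b k * (s k * s (Suc k))"
        by (simp add: a_def b_def distrib_right mult.assoc)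
    qed
    finally show ?thesis unfolding sS by (simp add: s_def)
  qed
  then have "(\<Sum>\<sigma>\<in>ising_configs N. ising_weight \<kappa> N \<sigma> * (spin_at N \<sigma> (int p) * spin_at N \<sigma> (int q)))
    = 2 ^ N * ((\<Prod>k<N. a k) + (\<Prod>k<N. b k))"
    unfolding sum_ring_periodic[OF N, symmetric] by (intro sum.cong) auto
  then show ?thesis unfolding a_def b_def split by (simp add: card)
qed

text \<open>Reduction modulo N can make the sites wrap around, so their residues differ by d or by N
  - d. The right-hand side is symmetric under exchanging these two arcs of the ring.\<close>

lemma sum_spin_pair:
  fixes x1 x2 :: int
  assumes "nat \<bar>x1 - x2\<bar> < N"
  defines "d \<equiv> nat \<bar>x1 - x2\<bar>"
  shows "(\<Sum>\<sigma>\<in>ising_configs N. ising_weight \<kappa> N \<sigma> * (spin_at N \<sigma> x1 * spin_at N \<sigma> x2))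
    = 2 ^ N * (sinh \<kappa> ^ d * cosh \<kappa> ^ (N - d) + cosh \<kappa> ^ d * sinh \<kappa> ^ (N - d))"
  using assms(1) unfolding d_def
proof (induction "nat (x1 mod int N)" "nat (x2 mod int N)" arbitrary: x1 x2 rule: linorder_wlog)
  case (sym x1 x2)
  from sym(1)[OF refl refl] sym(2) show ?case
    by (simp add: abs_minus_commute[of x1 x2] mult.commute[of "spin_at N _ x1"])
next
  case (le x1 x2)
  let ?p = "nat (x1 mod int N)" and ?q = "nat (x2 mod int N)" and ?d = "nat \<bar>x1 - x2\<bar>"
  have N: "N > 0" using le by simp
  have spin: "spin_at N \<sigma> (int (nat (x mod int N))) = spin_at N \<sigma> x" for \<sigma> x
    using N by (simp add: spin_at_def)
  have "?q - ?p = nat ((x2 - x1) mod int N)"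
  proof -
    have "x2 mod int N - x1 mod int N = (x2 mod int N - x1 mod int N) mod int N"
      using le N by (intro mod_pos_pos_trivial[symmetric])
        (auto simp: nat_le_eq_zle intro: le_less_trans[of _ "x2 mod int N"])
    also have "\<dots> = (x2 - x1) mod int N" by (simp add: mod_diff_eq)
    finally show ?thesis using N by (subst nat_diff_distrib'[symmetric]) auto
  qed
  moreover have "nat ((x2 - x1) mod int N) = ?d \<or> nat ((x2 - x1) mod int N) = N - ?d"
  proof (cases "x1 \<le> x2")
    case True
    then have "(x2 - x1) mod int N = x2 - x1"
      using le by (intro mod_pos_pos_trivial) auto
    with True show ?thesis by simp
  next
    case False
    have "(x2 - x1) mod int N = (x2 - x1 + int N) mod int N" by simp
    also have "\<dots> = x2 - x1 + int N"
      using le False by (intro mod_pos_pos_trivial) auto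
    finally show ?thesis using False by auto
  qed
  ultimately have "?q - ?p = ?d \<or> ?q - ?p = N - ?d" by simp
  moreover have "?q < N" using N by (simp add: nat_less_iff)
  ultimately show ?case
    using sum_spin_pair_ordered[OF le(1), of N \<kappa>] le(2) unfolding spin
    by (auto simp: algebra_simps)
qed

lemma sum_spin_single:
  assumes "N > 0"
  shows "(\<Sum>\<sigma>\<in>ising_configs N. ising_weight \<kappa> N \<sigma> * spin_at N \<sigma> x) = 0"
proof -
  \<comment> \<open>The global spin flip preserves the weight and negates each spin, so the sum
    equals its own negative. Restricting to the sites keeps the flipped configuration
    extensional.\<close>
  define \<phi> where "\<phi> = (\<lambda>\<sigma>::int \<Rightarrow> real. \<lambda>k\<in>{0..<int N}. - \<sigma> k)"
  have \<phi>: "\<phi> \<sigma> \<in> ising_configs N" "\<phi> (\<phi> \<sigma>) = \<sigma>" if "\<sigma> \<in> ising_configs N" for \<sigma>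
    using that by (auto simp: ising_configs_def \<phi>_def PiE_def Pi_def extensional_def fun_eq_iff)
  have spin: "spin_at N (\<phi> \<sigma>) k = - spin_at N \<sigma> k" for \<sigma> k
    using assms by (simp add: spin_at_def \<phi>_def)
  have weight: "ising_weight \<kappa> N (\<phi> \<sigma>) = ising_weight \<kappa> N \<sigma>" for \<sigma>
    by (simp add: ising_weight_def spin)
  have "(\<Sum>\<sigma>\<in>ising_configs N. ising_weight \<kappa> N \<sigma> * spin_at N \<sigma> x)
    = (\<Sum>\<sigma>\<in>ising_configs N. - (ising_weight \<kappa> N \<sigma> * spin_at N \<sigma> x))"
    by (rule sum.reindex_bij_witness[of _ \<phi> \<phi>]) (auto simp: \<phi> spin weight)
  then show ?thesis by (simp add: sum_negf)
qed

section \<open>Functions of two spins and their infinite-volume limit\<close>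

definition pair_mean :: "(real \<Rightarrow> real \<Rightarrow> real) \<Rightarrow> real" where
  "pair_mean G = (G 1 1 + G 1 (- 1) + G (- 1) 1 + G (- 1) (- 1)) / 4"

text \<open>Together with \<open>pair_mean\<close>, the coefficients of \<sigma>\<tau> and 1 when
  \<open>G\<close> is expanded in 1, \<sigma>, \<tau>, \<sigma>\<tau>. The other two drop out of
  expectations because single spins have mean zero.\<close>

definition pair_corr :: "(real \<Rightarrow> real \<Rightarrow> real) \<Rightarrow> real" where
  "pair_corr G = (G 1 1 - G 1 (- 1) - G (- 1) 1 + G (- 1) (- 1)) / 4"

text \<open>Used to keep the argument of the outer logarithm in \<open>S_tilde\<close> away from 0
  whenever the mean is positive.\<close>

lemma pair_corr_le_mean:
  assumes "\<And>a b. G a b \<ge> 0"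
  shows "\<bar>pair_corr G\<bar> \<le> pair_mean G"
  using assms[of 1 1] assms[of 1 "- 1"] assms[of "- 1" 1] assms[of "- 1" "- 1"]
  unfolding pair_corr_def pair_mean_def by (auto simp: field_simps abs_if)

lemma ising_expectation_sum:
  assumes "\<kappa> \<ge> 0" "N > 0"
  shows "ising_expectation \<kappa> N F =
    (\<Sum>\<sigma>\<in>ising_configs N. ising_weight \<kappa> N \<sigma> * F \<sigma>) / ising_partition \<kappa> N"
  unfolding ising_expectation_def ising_measure_def using ising_partition_pos[OF assms]
  by (subst lebesgue_integral_point_measure_finite)
     (auto simp: finite_ising_configs ising_weight_def sum_divide_distrib)

lemma ising_expectation_pair:
  assumes "\<kappa> \<ge> 0" "nat \<bar>x1 - x2\<bar> < N"
  defines "d \<equiv> nat \<bar>x1 - x2\<bar>"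
  shows "ising_expectation \<kappa> N (\<lambda>\<sigma>. G (spin_at N \<sigma> x1) (spin_at N \<sigma> x2)) =
    pair_mean G + pair_corr G * ((tanh \<kappa> ^ d + tanh \<kappa> ^ (N - d)) / (1 + tanh \<kappa> ^ N))"
proof -
  have N: "N > 0" using assms by simp
  let ?Z = "ising_partition \<kappa> N"
  have Z: "?Z > 0" using assms(1) N by (rule ising_partition_pos)
  define l where "l = (G 1 1 + G 1 (- 1) - G (- 1) 1 - G (- 1) (- 1)) / 4"
  define r where "r = (G 1 1 - G 1 (- 1) + G (- 1) 1 - G (- 1) (- 1)) / 4"
  let ?w = "ising_weight \<kappa> N"
  let ?S = "\<Sum>\<sigma>\<in>ising_configs N. ?w \<sigma> * (spin_at N \<sigma> x1 * spin_at N \<sigma> x2)"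
  have "G (spin_at N \<sigma> x1) (spin_at N \<sigma> x2) = pair_mean G + l * spin_at N \<sigma> x1
      + r * spin_at N \<sigma> x2 + pair_corr G * (spin_at N \<sigma> x1 * spin_at N \<sigma> x2)"
    if "\<sigma> \<in> ising_configs N" for \<sigma>
    using spin_at_cases[OF that N, of x1] spin_at_cases[OF that N, of x2]
    by (auto simp: pair_mean_def pair_corr_def l_def r_def field_simps)
  then have "(\<Sum>\<sigma>\<in>ising_configs N. ?w \<sigma> * G (spin_at N \<sigma> x1) (spin_at N \<sigma> x2))
    = (\<Sum>\<sigma>\<in>ising_configs N. pair_mean G * ?w \<sigma> + l * (?w \<sigma> * spin_at N \<sigma> x1)
      + r * (?w \<sigma> * spin_at N \<sigma> x2) + pair_corr G * (?w \<sigma> * (spin_at N \<sigma> x1 * spin_at N \<sigma> x2)))"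
    by (intro sum.cong) (auto simp: algebra_simps)
  also have "\<dots> = pair_mean G * ?Z + pair_corr G * ?S"
    unfolding sum.distrib sum_distrib_left[symmetric] sum_spin_single[OF N]
    by (simp add: ising_partition_def)
  finally have E: "ising_expectation \<kappa> N (\<lambda>\<sigma>. G (spin_at N \<sigma> x1) (spin_at N \<sigma> x2))
      = pair_mean G + pair_corr G * (?S / ?Z)"
    unfolding ising_expectation_sum[OF assms(1) N] using Z by (simp add: field_simps)
  define t where "t = tanh \<kappa>"
  have c: "cosh \<kappa> \<noteq> 0" by simp
  have sh: "sinh \<kappa> = t * cosh \<kappa>" by (simp add: t_def tanh_def)
  have cc: "cosh \<kappa> ^ N = cosh \<kappa> ^ d * cosh \<kappa> ^ (N - d)"
    using assms(2) by (simp add: d_def flip: power_add)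
  \<comment> \<open>Factoring 2^N cosh^N out of both sums leaves a ratio in t = tanh alone.\<close>
  have "?S = 2 ^ N * cosh \<kappa> ^ N * (t ^ d + t ^ (N - d))"
    unfolding sum_spin_pair[OF assms(2)] d_def[symmetric] sh cc
    by (simp add: power_mult_distrib algebra_simps)
  moreover have "?Z = 2 ^ N * cosh \<kappa> ^ N * (1 + t ^ N)"
    unfolding ising_partition_eq[OF N] sh by (simp add: power_mult_distrib algebra_simps)
  ultimately have "?S / ?Z = (t ^ d + t ^ (N - d)) / (1 + t ^ N)"
    using c by simp
  then show ?thesis unfolding E t_def by simp
qed

lemma ising_expectation_pair_tendsto:
  assumes "\<kappa> \<ge> 0"
  shows "(\<lambda>N. ising_expectation \<kappa> N (\<lambda>\<sigma>. G (spin_at N \<sigma> x1) (spin_at N \<sigma> x2)))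
    \<longlonglongrightarrow> pair_mean G + pair_corr G * tanh \<kappa> ^ nat \<bar>x1 - x2\<bar>"
proof -
  define d where "d = nat \<bar>x1 - x2\<bar>"
  have t: "\<bar>tanh \<kappa>\<bar> < 1" using assms tanh_real_lt_1[of \<kappa>] by simp
  have lim: "(\<lambda>N. tanh \<kappa> ^ N) \<longlonglongrightarrow> 0" using t by (intro LIMSEQ_power_zero) simp
  have "(\<lambda>N. tanh \<kappa> ^ (N - d)) \<longlonglongrightarrow> 0"
    by (rule LIMSEQ_offset[of _ d]) (simp add: lim)
  then have "(\<lambda>N. pair_mean G + pair_corr G * ((tanh \<kappa> ^ d + tanh \<kappa> ^ (N - d)) / (1 + tanh \<kappa> ^ N)))
      \<longlonglongrightarrow> pair_mean G + pair_corr G * ((tanh \<kappa> ^ d + 0) / (1 + 0))"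
    by (intro tendsto_intros lim) auto
  \<comment> \<open>The finite-ring formula is available only for N > d, which suffices for the
    limit.\<close>
  moreover have "\<forall>\<^sub>F N in sequentially.
      pair_mean G + pair_corr G * ((tanh \<kappa> ^ d + tanh \<kappa> ^ (N - d)) / (1 + tanh \<kappa> ^ N))
      = ising_expectation \<kappa> N (\<lambda>\<sigma>. G (spin_at N \<sigma> x1) (spin_at N \<sigma> x2))"
    using eventually_gt_at_top[of d]
    by eventually_elim (simp add: ising_expectation_pair[OF assms] d_def)
  ultimately show ?thesis
    unfolding d_def[symmetric] by (auto dest: Lim_transform_eventually)
qed

section \<open>Closed forms of the two parts of the observable\<close>

lemma continuous_on_xlogx: "continuous_on {0..} xlogx"
  unfolding continuous_on_def
proof
  fix x :: real
  assume "x \<in> {0..}"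
  then consider "x = 0" | "x > 0" by fastforce
  then show "(xlogx \<longlongrightarrow> xlogx x) (at x within {0..})"
  proof cases
    \<comment> \<open>The endpoint 0 matters: the limiting mean is 0 when, for instance, f vanishes
      on both spins.\<close>
    case 1
    have "((\<lambda>x::real. x * ln x) \<longlongrightarrow> 0) (at_right 0)" by real_asymp
    then show ?thesis by (simp add: 1 xlogx_def[abs_def] at_within_Ici_at_right)
  next
    case 2
    then show ?thesis unfolding xlogx_def[abs_def] by (intro tendsto_intros) auto
  qed
qed

text \<open>The logarithm sits inside the expectation and is absorbed into \<open>G\<close>, so the
  result is affine in the power of tanh.\<close>

lemma S_hat_eq:
  fixes f g :: "real \<Rightarrow> real"
  assumes "\<kappa> \<ge> 0"
  defines "G \<equiv> \<lambda>a b. xlogx ((f a)\<^sup>2 * (g b)\<^sup>2)"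
  shows "S_hat \<kappa> f g x1 x2 = pair_mean G + pair_corr G * tanh \<kappa> ^ nat \<bar>x1 - x2\<bar>"
  unfolding S_hat_def two_point_def G_def
  by (rule limI, rule ising_expectation_pair_tendsto[OF assms(1)])

text \<open>Here the logarithm acts on the expectation, so the limit passes through by continuity of
  \<open>xlogx\<close> on the closed half-line.\<close>

lemma S_tilde_eq:
  fixes f g :: "real \<Rightarrow> real"
  assumes "\<kappa> \<ge> 0"
  defines "G \<equiv> \<lambda>a b. (f a)\<^sup>2 * (g b)\<^sup>2"
  shows "S_tilde \<kappa> f g x1 x2 = xlogx (pair_mean G + pair_corr G * tanh \<kappa> ^ nat \<bar>x1 - x2\<bar>)"
  unfolding S_tilde_def two_point_def
proof (rule limI, rule continuous_on_tendsto_compose[OF continuous_on_xlogx])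
  let ?E = "\<lambda>N. ising_expectation \<kappa> N (\<lambda>\<sigma>. (f (spin_at N \<sigma> x1))\<^sup>2 * (g (spin_at N \<sigma> x2))\<^sup>2)"
  show lim: "?E \<longlonglongrightarrow> pair_mean G + pair_corr G * tanh \<kappa> ^ nat \<bar>x1 - x2\<bar>"
    unfolding G_def by (rule ising_expectation_pair_tendsto[OF assms(1)])
  have nonneg: "?E N \<ge> 0" for N
    unfolding ising_expectation_def by (intro Bochner_Integration.integral_nonneg) simp
  then show "\<forall>\<^sub>F N in sequentially. ?E N \<in> {0..}" by simp
  show "pair_mean G + pair_corr G * tanh \<kappa> ^ nat \<bar>x1 - x2\<bar> \<in> {0..}"
    using LIMSEQ_le_const[OF lim] nonneg by auto
qed

section \<open>Decay of the couplings and analytic estimates\<close>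

lemma rg_coupling_bounds:
  assumes "K \<ge> 0"
  shows "0 \<le> rg_coupling K n \<and> rg_coupling K n \<le> K / 2 ^ n"
proof (induction n)
  case 0
  show ?case using assms by simp
next
  case (Suc n)
  let ?k = "rg_coupling K n"
  \<comment> \<open>The recursion is half of log cosh, and 1 <= cosh k <= exp k for k >= 0, so each
    step at least halves the coupling.\<close>
  have "2 / (exp ?k + exp (- ?k)) = inverse (cosh ?k)" by (simp add: cosh_field_def divide_simps)
  then have *: "rg_coupling K (Suc n) = ln (cosh ?k) / 2" by (simp add: ln_inverse)
  have "cosh ?k \<le> exp ?k" using Suc by (simp add: cosh_field_def)
  then have "ln (cosh ?k) \<le> ?k"
    by (metis cosh_real_pos ln_exp ln_le_cancel_iff exp_gt_zero)
  moreover have "ln (cosh ?k) \<ge> 0" by (simp add: cosh_real_ge_1)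
  ultimately show ?case unfolding * using Suc by simp
qed

lemma tanh_le_double:
  fixes x :: real
  assumes "x \<ge> 0"
  shows "tanh x \<le> 2 * x"
proof -
  have "tanh x = (1 - exp (- 2 * x)) / (1 + exp (- 2 * x))" by (simp add: tanh_real_altdef)
  also have "\<dots> \<le> 1 - exp (- 2 * x)"
    using assms divide_left_mono[of 1 "1 + exp (- 2 * x)" "1 - exp (- 2 * x)"]
    by (simp add: add_pos_pos)
  also have "\<dots> \<le> 2 * x" using exp_ge_add_one_self[of "- 2 * x"] by simp
  finally show ?thesis .
qed

lemma decays_exponentially_le:
  assumes "decays_exponentially u" "\<And>n. \<bar>v n\<bar> \<le> L * \<bar>u n\<bar>"
  shows "decays_exponentially v"
proof -
  obtain C \<rho> where C: "C > 0" "0 < \<rho>" "\<rho> < 1" "\<And>n. n \<ge> 1 \<Longrightarrow> \<bar>u n\<bar> \<le> C * \<rho> ^ n"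
    using assms(1) unfolding decays_exponentially_def by blast
  \<comment> \<open>\<open>L\<close> may be zero or negative, while the constant in the definition
    of decay must be positive.\<close>
  have "\<bar>v n\<bar> \<le> (\<bar>L\<bar> + 1) * C * \<rho> ^ n" if "n \<ge> 1" for n
  proof -
    have "\<bar>v n\<bar> \<le> (\<bar>L\<bar> + 1) * \<bar>u n\<bar>"
      using assms(2)[of n] by (rule order_trans) (intro mult_right_mono, auto)
    also have "\<dots> \<le> (\<bar>L\<bar> + 1) * (C * \<rho> ^ n)"
      using C(4)[OF that] by (intro mult_left_mono) auto
    finally show ?thesis by (simp add: mult.assoc)
  qed
  then show ?thesis
    unfolding decays_exponentially_def using C
    by (intro exI[of _ "(\<bar>L\<bar> + 1) * C"] exI[of _ \<rho>]) auto
qed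

text \<open>Mean value inequality: the derivative ln z + 1 is bounded on an interval bounded away
  from 0.\<close>

lemma xlogx_lipschitz:
  assumes "0 < m" "x \<in> {m..M}" "y \<in> {m..M}"
  shows "\<bar>xlogx x - xlogx y\<bar> \<le> (1 + \<bar>ln m\<bar> + \<bar>ln M\<bar>) * \<bar>x - y\<bar>"
proof -
  have "norm (xlogx x - xlogx y) \<le> (1 + \<bar>ln m\<bar> + \<bar>ln M\<bar>) * norm (x - y)"
  proof (rule field_differentiable_bound[of "{m..M}" xlogx "\<lambda>z. ln z + 1"])
    fix z assume z: "z \<in> {m..M}"
    then show "(xlogx has_field_derivative ln z + 1) (at z within {m..M})"
      unfolding xlogx_def[abs_def] using assms(1) by (auto intro!: derivative_eq_intros)
    have "ln m \<le> ln z" "ln z \<le> ln M" using z assms(1) by auto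
    then show "norm (ln z + 1) \<le> 1 + \<bar>ln m\<bar> + \<bar>ln M\<bar>" by auto
  qed (use assms in auto)
  then show ?thesis by simp
qed

section \<open>Decay estimates for distinct sites\<close>

context
  fixes K :: real and d :: nat
  assumes K: "K > 0" and d: "d > 0"
begin

text \<open>Since d > 0, the power is at most its base. The interval, shared with the rescaled
  powers, ends below 1.\<close>

lemma tanh_rg_coupling_power: "tanh (rg_coupling K n) ^ d \<in> {0..tanh K}"
  "tanh (rg_coupling K n) ^ d \<le> 2 * K * (1 / 2) ^ n"
proof -
  let ?k = "rg_coupling K n"
  have k: "0 \<le> ?k" "?k \<le> K / 2 ^ n" using rg_coupling_bounds[of K n] K by auto
  have "K / 2 ^ n \<le> K" using K by (simp add: divide_le_eq)
  then have le: "tanh ?k \<le> tanh K" using k by (simp only: tanh_real_le_iff)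
  have pow: "tanh ?k ^ d \<le> tanh ?k"
    using power_decreasing[of 1 d "tanh ?k"] d k tanh_real_lt_1[of ?k] by simp
  show "tanh ?k ^ d \<in> {0..tanh K}" using order_trans[OF pow le] k(1) by simp
  show "tanh ?k ^ d \<le> 2 * K * (1 / 2) ^ n"
    using order_trans[OF pow tanh_le_double[OF k(1)]] k(2) by (simp add: power_one_over)
qed

lemma tanh_power_rescaled: "tanh K ^ (2 ^ n * d) \<in> {0..tanh K}"
  "tanh K ^ (2 ^ n * d) \<le> tanh K ^ n"
proof -
  have t: "0 \<le> tanh K" "tanh K \<le> 1" using K tanh_real_lt_1[of K] by auto
  have "1 \<le> 2 ^ n * d" using d by simp
  then show "tanh K ^ (2 ^ n * d) \<in> {0..tanh K}"
    using power_decreasing[of 1 "2 ^ n * d" "tanh K"] t by simp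
  \<comment> \<open>The doubly exponential decay is weakened to a geometric one.\<close>
  have "n \<le> 2 ^ n" using less_exp[of n] by simp
  also have "2 ^ n \<le> 2 ^ n * d" using d by simp
  finally show "tanh K ^ (2 ^ n * d) \<le> tanh K ^ n" using t by (intro power_decreasing) auto
qed

text \<open>Both terms decay separately; no cancellation between them enters.\<close>

lemma decays_tanh_difference:
  "decays_exponentially (\<lambda>n. tanh (rg_coupling K n) ^ d - tanh K ^ (2 ^ n * d))"
proof -
  \<comment> \<open>The slower of two rates: 1/2 from the halving of the coupling, tanh K from the
    growing distance.\<close>
  define \<rho> where "\<rho> = max (1 / 2) (tanh K)"
  have \<rho>: "0 < \<rho>" "\<rho> < 1" using tanh_real_lt_1[of K] by (auto simp: \<rho>_def)
  have "\<bar>tanh (rg_coupling K n) ^ d - tanh K ^ (2 ^ n * d)\<bar> \<le> (2 * K + 1) * \<rho> ^ n" for n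
  proof -
    have "2 * K * (1 / 2) ^ n \<le> 2 * K * \<rho> ^ n"
      using K by (intro mult_left_mono power_mono) (auto simp: \<rho>_def)
    moreover have "tanh K ^ n \<le> \<rho> ^ n" using K by (intro power_mono) (auto simp: \<rho>_def)
    ultimately show ?thesis
      using tanh_rg_coupling_power[of n] tanh_power_rescaled[of n]
      by (simp add: distrib_right abs_if)
  qed
  then show ?thesis
    unfolding decays_exponentially_def using \<rho> K
    by (intro exI[of _ "2 * K + 1"] exI[of _ \<rho>]) auto
qed

text \<open>If m > 0, both arguments lie between m (1 - tanh K) > 0 and 2 m, where
  \<open>xlogx\<close> is Lipschitz; if m = 0, then c = 0 and both sides vanish.\<close>

lemma xlogx_affine_lipschitz:
  assumes "\<bar>c\<bar> \<le> m" "u \<in> {0..tanh K}" "v \<in> {0..tanh K}"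
  defines "L \<equiv> 1 + \<bar>ln (m * (1 - tanh K))\<bar> + \<bar>ln (2 * m)\<bar>"
  shows "\<bar>xlogx (m + c * u) - xlogx (m + c * v)\<bar> \<le> L * \<bar>c\<bar> * \<bar>u - v\<bar>"
proof (cases "m = 0")
  case True
  then show ?thesis using assms by simp
next
  case False
  then have m: "m > 0" using assms(1) by linarith
  have t: "tanh K < 1" by (rule tanh_real_lt_1)
  have "m + c * w \<in> {m * (1 - tanh K)..2 * m}" if w: "w \<in> {0..tanh K}" for w
  proof -
    have "\<bar>c * w\<bar> \<le> m * tanh K"
      using w assms(1) m by (auto simp: abs_mult intro!: mult_mono)
    moreover have "m * tanh K \<le> m" using m t by simp
    ultimately show ?thesis by (auto simp: right_diff_distrib abs_le_iff)
  qed
  from xlogx_lipschitz[OF _ this[OF assms(2)] this[OF assms(3)]] m t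
  have "\<bar>xlogx (m + c * u) - xlogx (m + c * v)\<bar> \<le> L * \<bar>(m + c * u) - (m + c * v)\<bar>"
    by (simp add: L_def)
  also have "(m + c * u) - (m + c * v) = c * (u - v)" by (simp add: algebra_simps)
  finally show ?thesis by (simp add: abs_mult mult.assoc)
qed

end

section \<open>Decay of the remainder terms\<close>

lemma nat_abs_rescaled: "nat \<bar>2 ^ n * x1 - 2 ^ n * x2\<bar> = 2 ^ n * nat \<bar>x1 - x2\<bar>" for x1 x2 :: int
  by (simp add: abs_mult nat_mult_distrib nat_power_eq flip: right_diff_distrib)

theorem theorem4p2:
  fixes K :: real and f g :: "real \<Rightarrow> real" and x1 x2 :: int
  assumes "K > 0"
  shows "decays_exponentially (O_hat K f g x1 x2) \<and> decays_exponentially (O_tilde K f g x1 x2)"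
proof -
  define d where "d = nat \<bar>x1 - x2\<bar>"
  define H where "H = (\<lambda>a b. xlogx ((f a)\<^sup>2 * (g b)\<^sup>2))"
  define G where "G = (\<lambda>a b. (f a)\<^sup>2 * (g b)\<^sup>2)"
  define u where "u = (\<lambda>n. tanh (rg_coupling K n) ^ d)"
  define v where "v = (\<lambda>n. tanh K ^ (2 ^ n * d))"
  have k: "rg_coupling K n \<ge> 0" for n using rg_coupling_bounds[of K n] assms by simp
  have K: "K \<ge> 0" using assms by simp
  have hat: "O_hat K f g x1 x2 n = pair_corr H * (u n - v n)" for n
    unfolding O_hat_def S_hat_eq[OF k] S_hat_eq[OF K] nat_abs_rescaled H_def u_def v_def d_def
    by (simp add: right_diff_distrib)
  have tilde: "O_tilde K f g x1 x2 n =
      xlogx (pair_mean G + pair_corr G * u n) - xlogx (pair_mean G + pair_corr G * v n)" for n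
    unfolding O_tilde_def S_tilde_eq[OF k] S_tilde_eq[OF K] nat_abs_rescaled G_def u_def v_def d_def
    by simp
  show ?thesis
  proof (cases "d = 0")
    \<comment> \<open>For coinciding sites both powers equal 1, so both remainders are identically
      zero.\<close>
    case True
    then have "O_hat K f g x1 x2 n = 0" "O_tilde K f g x1 x2 n = 0" for n
      by (simp_all add: hat tilde u_def v_def)
    then show ?thesis
      unfolding decays_exponentially_def
      by (intro conjI exI[of _ 1] exI[of _ "1 / 2"]) auto
  next
    case False
    then have d: "d > 0" by simp
    have decay: "decays_exponentially (\<lambda>n. u n - v n)"
      unfolding u_def v_def by (rule decays_tanh_difference[OF assms d])
    have "\<bar>pair_corr G\<bar> \<le> pair_mean G" by (rule pair_corr_le_mean) (simp add: G_def)
    note lip = xlogx_affine_lipschitz[OF assms d this tanh_rg_coupling_power(1)[OF assms d]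
        tanh_power_rescaled(1)[OF assms d]]
    \<comment> \<open>The Lipschitz constant depends on K, f and g but not on n.\<close>
    have "\<exists>L. \<forall>n. \<bar>O_tilde K f g x1 x2 n\<bar> \<le> L * \<bar>u n - v n\<bar>"
      unfolding tilde u_def v_def by (intro exI allI, rule lip)
    then obtain L where L: "\<bar>O_tilde K f g x1 x2 n\<bar> \<le> L * \<bar>u n - v n\<bar>" for n
      by blast
    have "decays_exponentially (O_hat K f g x1 x2)"
      by (rule decays_exponentially_le[OF decay, of _ "\<bar>pair_corr H\<bar>"]) (simp add: hat abs_mult)
    moreover have "decays_exponentially (O_tilde K f g x1 x2)"
      by (rule decays_exponentially_le[OF decay]) (rule L)
    ultimately show ?thesis ..
  qed
qed

end
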